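(* For fixed integers $k\ge 1$ and $r\ge 2k+2\ge 4$, $$f(r,n,k)\le 2\binom{n}{r-1-2k}+O\left(n^{r-2k-2}\right)\qquad\text{as } n\to\infty,$$ where the implied constant may depend on $r$ and $k$.
   Context: An oriented matroid $\mathcal{M}=(E,\mathcal{C})$ is given by its finite ground set $E$ and its set $\mathcal{C}\subseteq\{+,-,0\}^E$ of signed circuits; for a sign vector $X$, $X^+$ and $X^-$ are the sets of positive and negative elements. All oriented matroids are simple (all circuits have size at least $3$). For $R\subseteq E$, the reorientation ${}_{-R}\mathcal{M}$ is obtained from $\mathcal{M}$ by reversing the sign of $X_e$ for every $e\in R$ and every circuit $X$. For an integer $k\ge 0$, $\mathcal{M}$ is $k$-neighborly if $|X^+|>k$ and $|X^-|>k$ for every circuit $X$. For $\mathcal{M}$ of rank $r$ on $n$ elements, $f_{\mathcal{M}}(r,n,k)$ is the number of subsets $R\subseteq E$ such that ${}_{-R}\mathcal{M}$ is $k$-neighborly, and $f(r,n,k)$ is the maximum of $f_{\mathcal{M}}(r,n,k)$ over all oriented matroids $\mathcal{M}$ of rank $r$ on $n$ elements. *)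

theory Defs
  imports Complex_Main "HOL-Library.Landau_Symbols"
begin

text \<open>
  A sign vector on E is a function with values in -1, 0, 1 that is extended by 0 outside E,
  so that equality of sign vectors is equality of functions.
\<close>

definition sign_vectors :: "'a set \<Rightarrow> ('a \<Rightarrow> int) set" where
  "sign_vectors E = {X. (\<forall>e\<in>E. X e \<in> {-1, 0, 1}) \<and> (\<forall>e. e \<notin> E \<longrightarrow> X e = 0)}"

definition pos :: "('a \<Rightarrow> int) \<Rightarrow> 'a set" where
  "pos X = {e. X e > 0}"

definition neg :: "('a \<Rightarrow> int) \<Rightarrow> 'a set" where
  "neg X = {e. X e < 0}"

definition support :: "('a \<Rightarrow> int) \<Rightarrow> 'a set" where
  "support X = {e. X e \<noteq> 0}"

text \<open>
  The signed circuit axioms; \<^term>\<open>- X\<close> is the pointwise negation, and the last axiom is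
  (weak) signed circuit elimination.
\<close>

locale oriented_matroid =
  fixes E :: "'a set" and \<C> :: "('a \<Rightarrow> int) set"
  assumes finite_ground: "finite E"
    and circuits_sign_vectors: "\<C> \<subseteq> sign_vectors E"
    and circuit_nonzero: "X \<in> \<C> \<Longrightarrow> support X \<noteq> {}"
    and circuit_uminus: "X \<in> \<C> \<Longrightarrow> - X \<in> \<C>"
    and circuit_incomparable:
      "X \<in> \<C> \<Longrightarrow> Y \<in> \<C> \<Longrightarrow> support X \<subseteq> support Y \<Longrightarrow> X = Y \<or> X = - Y"
    and circuit_elimination:
      "X \<in> \<C> \<Longrightarrow> Y \<in> \<C> \<Longrightarrow> X \<noteq> - Y \<Longrightarrow> e \<in> pos X \<inter> neg Y \<Longrightarrow>
        \<exists>Z\<in>\<C>. pos Z \<subseteq> (pos X \<union> pos Y) - {e} \<and> neg Z \<subseteq> (neg X \<union> neg Y) - {e}"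

locale simple_oriented_matroid = oriented_matroid +
  assumes circuit_size: "X \<in> \<C> \<Longrightarrow> card (support X) \<ge> 3"

definition om_indep :: "'a set \<Rightarrow> ('a \<Rightarrow> int) set \<Rightarrow> 'a set \<Rightarrow> bool" where
  "om_indep E \<C> I \<longleftrightarrow> I \<subseteq> E \<and> \<not> (\<exists>X\<in>\<C>. support X \<subseteq> I)"

definition om_rank :: "'a set \<Rightarrow> ('a \<Rightarrow> int) set \<Rightarrow> nat" where
  "om_rank E \<C> = Max (card ` {I. om_indep E \<C> I})"

definition reorient :: "'a set \<Rightarrow> ('a \<Rightarrow> int) set \<Rightarrow> ('a \<Rightarrow> int) set" where
  "reorient R \<C> = (\<lambda>X e. if e \<in> R then - X e else X e) ` \<C>"

definition neighborly :: "nat \<Rightarrow> ('a \<Rightarrow> int) set \<Rightarrow> bool" where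
  "neighborly k \<C> \<longleftrightarrow> (\<forall>X\<in>\<C>. card (pos X) > k \<and> card (neg X) > k)"

definition num_neighborly :: "'a set \<Rightarrow> ('a \<Rightarrow> int) set \<Rightarrow> nat \<Rightarrow> nat" where
  "num_neighborly E \<C> k = card {R. R \<subseteq> E \<and> neighborly k (reorient R \<C>)}"

text \<open>
  The maximum $f(r,n,k)$. Up to isomorphism every finite ground set is a set of natural numbers.
  The values are bounded by $2^n$, so that the supremum in \<^typ>\<open>nat\<close> is the maximum; it is 0 if
  there is no simple oriented matroid of rank r on n elements.
\<close>

definition max_neighborly :: "nat \<Rightarrow> nat \<Rightarrow> nat \<Rightarrow> nat" where
  "max_neighborly r n k =
    Sup {num_neighborly E \<C> k | (E :: nat set) \<C>.
      simple_oriented_matroid E \<C> \<and> card E = n \<and> om_rank E \<C> = r}"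

lemma num_neighborly_le:
  assumes "finite E"
  shows "num_neighborly E \<C> k \<le> 2 ^ card E"
proof -
  have "card {R. R \<subseteq> E \<and> neighborly k (reorient R \<C>)} \<le> card (Pow E)"
    using assms by (intro card_mono) auto
  then show ?thesis
    using assms by (simp add: num_neighborly_def card_Pow)
qed

lemma num_neighborly_le_max_neighborly:
  fixes E :: "nat set"
  assumes "simple_oriented_matroid E \<C>"
  shows "num_neighborly E \<C> k \<le> max_neighborly (om_rank E \<C>) (card E) k"
  unfolding max_neighborly_def
proof (rule cSup_upper)
  show "bdd_above {num_neighborly E' \<C>' k | (E' :: nat set) \<C>'.
      simple_oriented_matroid E' \<C>' \<and> card E' = card E \<and> om_rank E' \<C>' = om_rank E \<C>}"
  proof (rule bdd_aboveI)
    fix m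
    assume "m \<in> {num_neighborly E' \<C>' k | (E' :: nat set) \<C>'.
      simple_oriented_matroid E' \<C>' \<and> card E' = card E \<and> om_rank E' \<C>' = om_rank E \<C>}"
    then obtain E' :: "nat set" and \<C>' where
      "m = num_neighborly E' \<C>' k" "simple_oriented_matroid E' \<C>'" "card E' = card E"
      by blast
    moreover from this have "finite E'"
      by (simp add: simple_oriented_matroid_def oriented_matroid_def)
    ultimately show "m \<le> 2 ^ card E"
      using num_neighborly_le[of E' \<C>' k] by simp
  qed
qed (use assms in blast)

end

theory Submission
  imports Defs
begin

text \<open>
  The bound comes from a deletion-contraction recursion. Restricting the \<open>k\<close>-neighborly
  reorientations of \<open>\<M>\<close> to \<open>E - {e}\<close> gives \<open>k\<close>-neighborly reorientations of \<open>\<M>\<setminus>e\<close>. A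
  reorientation arises twice in this way only if both orientations of \<open>e\<close> are possible. Then
  \<open>e\<close> is positive in a circuit \<open>X\<close> through \<open>e\<close> for one of them and negative for the other, so the
  inequalities \<open>|X\<^sup>+| > k\<close> and \<open>|X\<^sup>-| > k\<close> hold without counting \<open>e\<close>, and the reorientation is
  also \<open>k\<close>-neighborly for \<open>\<M>/e\<close>. Writing \<open>N\<close> for the number of \<open>k\<close>-neighborly
  reorientations, this gives
  \<open>N \<M> \<le> N (\<M>\<setminus>e) + N (\<M>/e)\<close> (\<open>num_neighborly_deletion_contraction\<close>), which is Pascal's rule
  with one element less and with rank \<open>r\<close> and \<open>r - 1\<close>, respectively.

  The recursion is started in rank \<open>2 * k + 1\<close>, where \<open>N \<M> \<le> 2\<close> as soon as there are at least
  \<open>2 * k + 3\<close> elements (\<open>num_neighborly_le_2\<close>). Indeed, a neighborly reorientation forces every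
  circuit to have at least \<open>2 * k + 2\<close> elements, while in rank \<open>2 * k + 1\<close> every set of
  \<open>2 * k + 2\<close> elements contains a circuit; hence every such set is a circuit and has equally
  many positive and negative elements. If two neighborly reorientations differ in the set \<open>D\<close>,
  then every set of \<open>2 * k + 2\<close> elements meets \<open>D\<close> in an even number of elements, and exchanging
  one element shows that \<open>D\<close> is empty or everything.

  With \<open>r = 2 * k + 1 + d\<close>, Pascal's rule now yields
  \<open>N \<M> \<le> 2 * (n choose d) + 2 ^ (2 * k + 3) * (\<Sum>i<d. n choose i)\<close> for \<open>n \<ge> 2 * k + 3\<close>
  (\<open>num_neighborly_bound\<close>); the trivial bound \<open>2 ^ n\<close> at \<open>n = 2 * k + 3\<close> accounts for the
  second term, which is of order \<open>n ^ (d - 1)\<close>.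
\<close>

section \<open>Deletion and contraction\<close>

text \<open>
  The bound on the rank is phrased through circuits inside sets of \<open>r + 1\<close> elements because in this form
  it passes directly to deletion, with the same \<open>r\<close> even if \<open>e\<close> is a coloop, and to
  contraction, with \<open>r - 1\<close>.
\<close>

definition rank_at_most :: "'a set \<Rightarrow> ('a \<Rightarrow> int) set \<Rightarrow> nat \<Rightarrow> bool" where
  "rank_at_most E \<C> r \<longleftrightarrow> (\<forall>A\<subseteq>E. card A = Suc r \<longrightarrow> (\<exists>X\<in>\<C>. support X \<subseteq> A))"

definition deletion :: "'a \<Rightarrow> ('a \<Rightarrow> int) set \<Rightarrow> ('a \<Rightarrow> int) set" where
  "deletion e \<C> = {X \<in> \<C>. X e = 0}"

text \<open>
  Contracting an oriented matroid leaves only the vectors of minimal support. The non-minimal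
  ones are kept here; they do not change which reorientations are neighborly, because each of
  them is a conformal composition of circuits.
\<close>

definition contraction :: "'a \<Rightarrow> ('a \<Rightarrow> int) set \<Rightarrow> ('a \<Rightarrow> int) set" where
  "contraction e \<C> = (\<lambda>X. X(e := 0)) ` \<C>"

lemma rank_at_most_om_rank:
  assumes "oriented_matroid E \<C>"
  shows "rank_at_most E \<C> (om_rank E \<C>)"
  unfolding rank_at_most_def
proof (intro allI impI)
  fix A assume A: "A \<subseteq> E" "card A = Suc (om_rank E \<C>)"
  have "finite E"
    using assms by (simp add: oriented_matroid_def)
  then have fin: "finite {I. om_indep E \<C> I}"
    by (rule rev_finite_subset[OF finite_Pow_iff[THEN iffD2]]) (auto simp: om_indep_def)
  show "\<exists>X\<in>\<C>. support X \<subseteq> A"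
  proof (rule ccontr)
    assume "\<not> ?thesis"
    with A have "om_indep E \<C> A"
      by (simp add: om_indep_def)
    with fin have "card A \<le> om_rank E \<C>"
      unfolding om_rank_def by (intro Max_ge) auto
    with A show False by simp
  qed
qed

lemma rank_at_most_deletion:
  assumes "rank_at_most E \<C> r"
  shows "rank_at_most (E - {e}) (deletion e \<C>) r"
  unfolding rank_at_most_def
proof (intro allI impI)
  fix A assume A: "A \<subseteq> E - {e}" "card A = Suc r"
  with assms obtain X where "X \<in> \<C>" "support X \<subseteq> A"
    unfolding rank_at_most_def by blast
  moreover from this A have "X e = 0"
    by (auto simp: support_def)
  ultimately show "\<exists>X\<in>deletion e \<C>. support X \<subseteq> A"
    by (auto simp: deletion_def)
qed

lemma rank_at_most_contraction:
  assumes "rank_at_most E \<C> (Suc r)" and "e \<in> E"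
  shows "rank_at_most (E - {e}) (contraction e \<C>) r"
  unfolding rank_at_most_def
proof (intro allI impI)
  fix A assume A: "A \<subseteq> E - {e}" "card A = Suc r"
  then have "finite A"
    by (intro card_ge_0_finite) simp
  with A have "card (insert e A) = Suc (Suc r)"
    by (subst card_insert_disjoint) auto
  with A assms obtain X where "X \<in> \<C>" "support X \<subseteq> insert e A"
    unfolding rank_at_most_def by (metis Diff_empty insert_subset subset_Diff_insert)
  then have "X(e := 0) \<in> contraction e \<C>" "support (X(e := 0)) \<subseteq> A"
    by (auto simp: contraction_def support_def)
  then show "\<exists>X\<in>contraction e \<C>. support X \<subseteq> A"
    by blast
qed

section \<open>The recursion for the number of neighborly reorientations\<close>

definition flip :: "'a set \<Rightarrow> ('a \<Rightarrow> int) \<Rightarrow> 'a \<Rightarrow> int" where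
  "flip R X = (\<lambda>e. if e \<in> R then - X e else X e)"

lemma reorient_eq_flip: "reorient R \<C> = flip R ` \<C>"
  by (simp add: reorient_def flip_def)

lemma neighborly_reorient_iff:
  "neighborly k (reorient R \<C>) \<longleftrightarrow>
    (\<forall>X\<in>\<C>. card (pos (flip R X)) > k \<and> card (neg (flip R X)) > k)"
  by (simp add: neighborly_def reorient_eq_flip)

lemma flip_cong:
  assumes "\<And>e. X e \<noteq> 0 \<Longrightarrow> e \<in> R \<longleftrightarrow> e \<in> S"
  shows "flip R X = flip S X"
  using assms by (fastforce simp: flip_def)

lemma neighborly_deletion:
  assumes "neighborly k (reorient R \<C>)"
  shows "neighborly k (reorient (R - {e}) (deletion e \<C>))"
proof -
  have "flip (R - {e}) X = flip R X" if "X e = 0" for X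
    using that by (intro flip_cong) auto
  with assms show ?thesis
    by (auto simp: neighborly_reorient_iff deletion_def)
qed

text \<open>
  The positive elements of a circuit off \<open>e\<close> are its positive elements with respect to that one
  of the two orientations of \<open>e\<close> which makes \<open>e\<close> non-positive, so they number more than \<open>k\<close>;
  likewise for the negative elements.
\<close>

lemma neighborly_contraction:
  assumes "e \<notin> R" and "neighborly k (reorient R \<C>)"
    and "neighborly k (reorient (insert e R) \<C>)"
  shows "neighborly k (reorient R (contraction e \<C>))"
  unfolding neighborly_reorient_iff contraction_def
proof (clarify, intro conjI)
  fix X assume X: "X \<in> \<C>"
  let ?Y = "flip R (X(e := 0))"
  have "pos ?Y = pos (flip R X) \<or> pos ?Y = pos (flip (insert e R) X)"
    using assms(1) by (cases "X e > 0") (auto simp: pos_def flip_def)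
  with X assms(2,3) show "card (pos ?Y) > k"
    by (auto simp: neighborly_reorient_iff)
  have "neg ?Y = neg (flip R X) \<or> neg ?Y = neg (flip (insert e R) X)"
    using assms(1) by (cases "X e < 0") (auto simp: neg_def flip_def)
  with X assms(2,3) show "card (neg ?Y) > k"
    by (auto simp: neighborly_reorient_iff)
qed

lemma num_neighborly_deletion_contraction:
  assumes "finite E" and "e \<in> E"
  shows "num_neighborly E \<C> k \<le>
    num_neighborly (E - {e}) (deletion e \<C>) k + num_neighborly (E - {e}) (contraction e \<C>) k"
proof -
  define F where "F = {R. R \<subseteq> E \<and> neighborly k (reorient R \<C>)}"
  define F0 where "F0 = {R \<in> F. e \<notin> R}"
  define F1 where "F1 = {R \<in> F. e \<in> R}"
  define F1' where "F1' = (\<lambda>R. R - {e}) ` F1"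
  have fin: "finite F"
    using assms by (simp add: F_def)
  then have fin': "finite F0" "finite F1" "finite F1'"
    by (simp_all add: F0_def F1_def F1'_def)
  have "F = F0 \<union> F1" "F0 \<inter> F1 = {}"
    by (auto simp: F0_def F1_def)
  then have "card F = card F0 + card F1"
    using fin' by (simp add: card_Un_disjoint)
  moreover have "card F1 = card F1'"
    unfolding F1'_def by (rule card_image[symmetric]) (auto simp: inj_on_def F1_def)
  moreover have "card F0 + card F1' = card (F0 \<union> F1') + card (F0 \<inter> F1')"
    using fin' by (intro card_Un_Int)
  moreover have "card (F0 \<union> F1') \<le> num_neighborly (E - {e}) (deletion e \<C>) k"
    unfolding num_neighborly_def
  proof (rule card_mono)
    show "F0 \<union> F1' \<subseteq> {R. R \<subseteq> E - {e} \<and> neighborly k (reorient R (deletion e \<C>))}"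
    proof
      fix S assume "S \<in> F0 \<union> F1'"
      then obtain R where "R \<in> F" "S = R - {e}"
        by (auto simp: F0_def F1'_def F1_def)
      then show "S \<in> {R. R \<subseteq> E - {e} \<and> neighborly k (reorient R (deletion e \<C>))}"
        using neighborly_deletion[of k R \<C> e] by (auto simp: F_def)
    qed
  qed (use assms in simp)
  moreover have "card (F0 \<inter> F1') \<le> num_neighborly (E - {e}) (contraction e \<C>) k"
    unfolding num_neighborly_def
  proof (rule card_mono)
    show "F0 \<inter> F1' \<subseteq> {R. R \<subseteq> E - {e} \<and> neighborly k (reorient R (contraction e \<C>))}"
    proof
      fix R assume R: "R \<in> F0 \<inter> F1'"
      then have "e \<notin> R" "R \<in> F" "insert e R \<in> F"
        by (auto simp: F0_def F1'_def F1_def insert_absorb)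
      then show "R \<in> {R. R \<subseteq> E - {e} \<and> neighborly k (reorient R (contraction e \<C>))}"
        using neighborly_contraction[of e R k \<C>] by (auto simp: F_def)
    qed
  qed (use assms in simp)
  moreover have "num_neighborly E \<C> k = card F"
    by (simp add: F_def num_neighborly_def)
  ultimately show ?thesis
    by linarith
qed

section \<open>Rank $2k+1$\<close>

lemma pos_Un_neg: "pos X \<union> neg X = support X"
  by (auto simp: pos_def neg_def support_def)

lemma pos_Int_neg: "pos X \<inter> neg X = {}"
  by (auto simp: pos_def neg_def)

lemma support_flip: "support (flip R X) = support X"
  by (auto simp: support_def flip_def)

text \<open>
  More than \<open>k\<close> positive and more than \<open>k\<close> negative elements exhaust a support of \<open>2 * k + 2\<close>
  elements.
\<close>

lemma balanced_if_support_small: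
  assumes "support X \<subseteq> A" and "card A = 2 * k + 2"
    and "card (pos X) > k" and "card (neg X) > k"
  shows "card (pos X) = k + 1" and "card (neg X) = k + 1" and "support X = A"
proof -
  have "finite A"
    using assms(2) by (intro card_ge_0_finite) simp
  then have fin: "finite (support X)"
    using assms(1) by (rule rev_finite_subset)
  have "finite (pos X)" "finite (neg X)"
    using fin by (simp_all flip: pos_Un_neg)
  then have "card (support X) = card (pos X) + card (neg X)"
    using pos_Int_neg[of X] by (simp add: card_Un_disjoint flip: pos_Un_neg)
  moreover have "card (support X) \<le> card A"
    using \<open>finite A\<close> assms(1) by (rule card_mono)
  ultimately show "card (pos X) = k + 1" "card (neg X) = k + 1" "support X = A"
    using assms card_subset_eq[OF \<open>finite A\<close> assms(1)] by linarith+
qed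

text \<open>
  Both reorientations of the circuit supported on \<open>A\<close> have \<open>k + 1\<close> positive elements, so passing
  from one to the other turns as many positive elements negative as conversely.
\<close>

lemma even_card_Int_difference:
  assumes rank: "rank_at_most E \<C> (2 * k + 1)"
    and R: "neighborly k (reorient R \<C>)" and S: "neighborly k (reorient S \<C>)"
    and A: "A \<subseteq> E" "card A = 2 * k + 2"
  shows "even (card (A \<inter> {e. (e \<in> R) \<noteq> (e \<in> S)}))"
proof -
  define D where "D = {e. (e \<in> R) \<noteq> (e \<in> S)}"
  obtain X where X: "X \<in> \<C>" "support X \<subseteq> A"
    using rank A unfolding rank_at_most_def by auto
  define Y where "Y = flip R X"
  have flip_Y: "flip D Y = flip S X"
    by (auto simp: fun_eq_iff Y_def flip_def D_def)
  have Y: "card (pos Y) = k + 1" "support Y = A"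
    using balanced_if_support_small[of Y A k] X A R
    by (auto simp: Y_def support_flip neighborly_reorient_iff)
  have flipped: "card (pos (flip D Y)) = k + 1"
    using balanced_if_support_small[of "flip S X" A k] X A S
    by (auto simp: flip_Y support_flip neighborly_reorient_iff)
  have "finite A"
    using A by (intro card_ge_0_finite) simp
  then have fin: "finite (pos Y)" "finite (neg Y)"
    using Y(2) by (auto simp flip: pos_Un_neg)
  have "pos (flip D Y) = (pos Y - D) \<union> (neg Y \<inter> D)"
    by (auto simp: pos_def neg_def flip_def split: if_splits)
  then have "k + 1 = card (pos Y - D) + card (neg Y \<inter> D)"
    using fin flipped card_Un_disjoint[of "pos Y - D" "neg Y \<inter> D"] by auto
  moreover have "k + 1 = card (pos Y - D) + card (pos Y \<inter> D)"
    using fin Y(1) card_Diff_subset_Int[of "pos Y" D] card_mono[of "pos Y" "pos Y \<inter> D"] by simp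
  moreover have "card (A \<inter> D) = card (pos Y \<inter> D) + card (neg Y \<inter> D)"
  proof -
    have "A \<inter> D = (pos Y \<inter> D) \<union> (neg Y \<inter> D)"
      using Y(2) pos_Un_neg[of Y] by auto
    then show ?thesis
      using fin pos_Int_neg[of Y] by (auto intro!: card_Un_disjoint)
  qed
  ultimately show ?thesis
    by (simp add: D_def)
qed

lemma ex_odd_card_Int:
  assumes "finite E" and "2 * k + 3 \<le> card E"
    and "a \<in> E" "a \<in> D" and "b \<in> E" "b \<notin> D"
  shows "\<exists>A\<subseteq>E. card A = 2 * k + 2 \<and> odd (card (A \<inter> D))"
proof -
  have "a \<noteq> b"
    using assms by auto
  then have "2 * k + 1 \<le> card (E - {a, b})"
    using assms by (subst card_Diff_subset) auto
  then obtain B where B: "B \<subseteq> E - {a, b}" "card B = 2 * k + 1" "finite B"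
    by (rule obtain_subset_with_card_n)
  \<comment> \<open>Adding \<open>a\<close> or \<open>b\<close> to \<open>B\<close> gives two sets whose intersections with \<open>D\<close> differ by one element.\<close>
  have "insert a B \<inter> D = insert a (B \<inter> D)" "insert b B \<inter> D = B \<inter> D"
    using assms by auto
  moreover have "card (insert a (B \<inter> D)) = Suc (card (B \<inter> D))"
    using B by (subst card_insert_disjoint) auto
  ultimately have "odd (card (insert a B \<inter> D)) \<or> odd (card (insert b B \<inter> D))"
    by simp
  moreover have "insert a B \<subseteq> E" "insert b B \<subseteq> E"
    using assms B by auto
  moreover have "card (insert a B) = 2 * k + 2" "card (insert b B) = 2 * k + 2"
    using B by (subst card_insert_disjoint; auto)+
  ultimately show ?thesis
    by blast
qed

lemma num_neighborly_le_2:
  assumes "finite E" and "2 * k + 3 \<le> card E" and "rank_at_most E \<C> (2 * k + 1)"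
  shows "num_neighborly E \<C> k \<le> 2"
proof (cases "\<exists>R\<subseteq>E. neighborly k (reorient R \<C>)")
  case True
  then obtain R where R: "R \<subseteq> E" "neighborly k (reorient R \<C>)"
    by blast
  have "{S. S \<subseteq> E \<and> neighborly k (reorient S \<C>)} \<subseteq> {R, E - R}"
  proof
    fix S assume "S \<in> {S. S \<subseteq> E \<and> neighborly k (reorient S \<C>)}"
    then have S: "S \<subseteq> E" "neighborly k (reorient S \<C>)"
      by auto
    define D where "D = {e. (e \<in> R) \<noteq> (e \<in> S)}"
    have "even (card (A \<inter> D))" if "A \<subseteq> E" "card A = 2 * k + 2" for A
      unfolding D_def using even_card_Int_difference[OF assms(3) R(2) S(2) that] .
    then have "\<not> (\<exists>a b. a \<in> E \<and> a \<in> D \<and> b \<in> E \<and> b \<notin> D)"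
      using ex_odd_card_Int[OF assms(1,2)] by blast
    then show "S \<in> {R, E - R}"
      using R(1) S(1) by (auto simp: D_def)
  qed
  then have "num_neighborly E \<C> k \<le> card {R, E - R}"
    unfolding num_neighborly_def by (rule card_mono[rotated]) simp
  also have "\<dots> \<le> 2"
    by (simp add: card_insert_if)
  finally show ?thesis .
next
  case False
  then have "{R. R \<subseteq> E \<and> neighborly k (reorient R \<C>)} = {}"
    by auto
  then show ?thesis
    by (simp only: num_neighborly_def card.empty)
qed

section \<open>The bound in arbitrary rank\<close>

text \<open>
  The induction starts at the first number of elements to which \<open>num_neighborly_le_2\<close> applies.
  There the trivial bound \<open>2 ^ n\<close> suffices for \<open>d > 0\<close>, as the sum contains \<open>n choose 0\<close>.
\<close>

lemma num_neighborly_bound: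
  assumes "2 * k + 3 \<le> n"
    and "finite E" and "card E = n" and "rank_at_most E \<C> (2 * k + 1 + d)"
  shows "num_neighborly E \<C> k \<le> 2 * (n choose d) + 2 ^ (2 * k + 3) * (\<Sum>i<d. n choose i)"
  using assms
proof (induction n arbitrary: d E \<C> rule: nat_induct_at_least)
  case base
  show ?case
  proof (cases d)
    case 0
    then show ?thesis
      using num_neighborly_le_2[of E k \<C>] base by simp
  next
    case (Suc d')
    have "num_neighborly E \<C> k \<le> 2 ^ (2 * k + 3) * 1"
      using num_neighborly_le[of E \<C> k] base by simp
    also have "\<dots> \<le> 2 ^ (2 * k + 3) * (\<Sum>i<d. (2 * k + 3) choose i)"
      by (intro mult_left_mono) (simp_all only: Suc sum.lessThan_Suc_shift, simp_all)
    finally show ?thesis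
      by simp
  qed
next
  case (Suc n)
  show ?case
  proof (cases d)
    case 0
    then show ?thesis
      using num_neighborly_le_2[of E k \<C>] Suc by simp
  next
    case d: (Suc d')
    obtain e where e: "e \<in> E"
      using Suc.prems by fastforce
    have card: "finite (E - {e})" "card (E - {e}) = n"
      using e Suc.prems by simp_all
    have "num_neighborly E \<C> k \<le>
        num_neighborly (E - {e}) (deletion e \<C>) k + num_neighborly (E - {e}) (contraction e \<C>) k"
      using Suc.prems e by (intro num_neighborly_deletion_contraction)
    also have "num_neighborly (E - {e}) (deletion e \<C>) k \<le>
        2 * (n choose d) + 2 ^ (2 * k + 3) * (\<Sum>i<d. n choose i)"
      using card Suc.prems(3) by (intro Suc.IH rank_at_most_deletion)
    also have "num_neighborly (E - {e}) (contraction e \<C>) k \<le>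
        2 * (n choose d') + 2 ^ (2 * k + 3) * (\<Sum>i<d'. n choose i)"
      using card Suc.prems(3) e d by (intro Suc.IH rank_at_most_contraction) simp_all
    also have "2 * (n choose d) + 2 ^ (2 * k + 3) * (\<Sum>i<d. n choose i) +
        (2 * (n choose d') + 2 ^ (2 * k + 3) * (\<Sum>i<d'. n choose i)) =
        2 * (Suc n choose d) + 2 ^ (2 * k + 3) * (\<Sum>i<d. Suc n choose i)"
    proof -
      have "(\<Sum>i<Suc d'. Suc n choose i) = (\<Sum>i<Suc d'. n choose i) + (\<Sum>i<d'. n choose i)"
        by (simp only: sum.lessThan_Suc_shift) (simp add: sum.distrib)
      then show ?thesis
        by (simp only: d) (simp add: algebra_simps)
    qed
    finally show ?thesis
      by simp
  qed
qed

lemma max_neighborly_bound: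
  assumes "2 * k + 3 \<le> n"
  shows "max_neighborly (2 * k + 1 + d) n k \<le>
    2 * (n choose d) + 2 ^ (2 * k + 3) * (\<Sum>i<d. n choose i)"
proof -
  define V where "V = {num_neighborly E \<C> k | (E :: nat set) \<C>.
    simple_oriented_matroid E \<C> \<and> card E = n \<and> om_rank E \<C> = 2 * k + 1 + d}"
  have "v \<le> 2 * (n choose d) + 2 ^ (2 * k + 3) * (\<Sum>i<d. n choose i)" if "v \<in> V" for v
  proof -
    obtain E :: "nat set" and \<C> where v: "v = num_neighborly E \<C> k"
      "oriented_matroid E \<C>" "card E = n" "om_rank E \<C> = 2 * k + 1 + d"
      using \<open>v \<in> V\<close> unfolding V_def simple_oriented_matroid_def by blast
    then have "rank_at_most E \<C> (2 * k + 1 + d)" "finite E"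
      using rank_at_most_om_rank[of E \<C>] oriented_matroid.finite_ground[of E \<C>] by simp_all
    with v assms show ?thesis
      using num_neighborly_bound by blast
  qed
  moreover have "max_neighborly (2 * k + 1 + d) n k = Sup V"
    by (simp only: max_neighborly_def V_def)
  moreover have "Sup V = 0" if "V = {}"
    using that by (simp add: Sup_nat_def)
  ultimately show ?thesis
    using cSup_least[of V] by (cases "V = {}") auto
qed

lemma sum_choose_bigo:
  "(\<lambda>n. real (\<Sum>i<Suc d. n choose i)) \<in> O(\<lambda>n. real n ^ d)"
proof (rule bigoI)
  show "\<forall>\<^sub>F n in sequentially.
    norm (real (\<Sum>i<Suc d. n choose i)) \<le> real (Suc d) * norm (real n ^ d)"
    using eventually_ge_at_top[of 1]
  proof eventually_elim
    case (elim n)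
    have "n choose i \<le> n ^ d" if "i < Suc d" for i
    proof -
      have "n choose i \<le> n ^ i"
        by (cases "i \<le> n") (simp_all add: binomial_le_pow binomial_eq_0)
      also have "\<dots> \<le> n ^ d"
        using elim that by (intro power_increasing) auto
      finally show ?thesis .
    qed
    then have "(\<Sum>i<Suc d. n choose i) \<le> Suc d * n ^ d"
      using sum_bounded_above[of "{..<Suc d}" "\<lambda>i. n choose i" "n ^ d"] by simp
    then have "real (\<Sum>i<Suc d. n choose i) \<le> real (Suc d * n ^ d)"
      by (rule of_nat_mono)
    then show ?case
      by (simp only: of_nat_mult of_nat_power norm_of_nat norm_power)
  qed
qed

theorem corollary3p10:
  fixes k r :: nat
  assumes "k \<ge> 1" and "r \<ge> 2 * k + 2"
  shows "\<exists>g :: nat \<Rightarrow> real. g \<in> O(\<lambda>n. real n ^ (r - 2 * k - 2)) \<and>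
    (\<forall>\<^sub>F n in sequentially.
      real (max_neighborly r n k) \<le> 2 * real (n choose (r - 1 - 2 * k)) + g n)"
proof -
  define d where "d = r - 2 * k - 2"
  have r: "r = 2 * k + 1 + Suc d" "r - 1 - 2 * k = Suc d"
    using assms(2) by (simp_all add: d_def)
  define g where "g = (\<lambda>n. 2 ^ (2 * k + 3) * real (\<Sum>i<Suc d. n choose i))"
  have "g \<in> O(\<lambda>n. real n ^ d)"
    unfolding g_def by (intro landau_o.big.cmult_in_iff[THEN iffD2] sum_choose_bigo) simp
  moreover have "\<forall>\<^sub>F n in sequentially.
      real (max_neighborly r n k) \<le> 2 * real (n choose (r - 1 - 2 * k)) + g n"
    using eventually_ge_at_top[of "2 * k + 3"]
  proof eventually_elim
    case (elim n)
    have "real (max_neighborly r n k) \<le>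
        real (2 * (n choose Suc d) + 2 ^ (2 * k + 3) * (\<Sum>i<Suc d. n choose i))"
      unfolding r(1) using max_neighborly_bound[OF elim] by (rule of_nat_mono)
    then show ?case
      by (simp only: r(2) g_def of_nat_add of_nat_mult of_nat_power of_nat_numeral)
  qed
  ultimately show ?thesis
    unfolding d_def by blast
qed

end
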